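(* Let $X$ be a finite-dimensional real Banach space with $\dim X>1$ and let $Y$ be any real Banach space. Let $T,A\in\mathbb{L}(X,Y)$. Then $T\perp_B A$ if and only if there exist $x,y\in M_T$ such that $Ax\in (Tx)^+$ and $Ay\in (Ty)^-$.
   Context: $\mathbb{L}(X,Y)$ is the Banach space of all continuous linear operators from $X$ to $Y$ with the operator norm. Birkhoff-James orthogonality in a real normed space: $u\perp_B v$ iff $\|u\|\le\|u+\lambda v\|$ for all $\lambda\in\mathbb{R}$; $T\perp_B A$ is taken with respect to the operator norm. $M_T=\{x\in X:\|x\|=1,\ \|Tx\|=\|T\|\}$. For $u,v\in Y$: $v\in u^+$ iff $\|u+\lambda v\|\ge\|u\|$ for all $\lambda\ge0$; $v\in u^-$ iff $\|u+\lambda v\|\ge\|u\|$ for all $\lambda\le0$. *)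

theory Defs
  imports "HOL-Analysis.Analysis"
begin

definition bj_orth :: "'a::real_normed_vector \<Rightarrow> 'a \<Rightarrow> bool"  (infix \<open>\<bottom>\<^sub>B\<close> 50)
  where "u \<bottom>\<^sub>B v \<longleftrightarrow> (\<forall>t::real. norm u \<le> norm (u + t *\<^sub>R v))"

definition norm_attainment_set :: "('a::real_normed_vector \<Rightarrow>\<^sub>L 'b::real_normed_vector) \<Rightarrow> 'a set"
  where "norm_attainment_set T = {x. norm x = 1 \<and> norm (blinfun_apply T x) = norm T}"

definition plus_set :: "'a::real_normed_vector \<Rightarrow> 'a set"
  where "plus_set u = {v. \<forall>t::real. t \<ge> 0 \<longrightarrow> norm (u + t *\<^sub>R v) \<ge> norm u}"

definition minus_set :: "'a::real_normed_vector \<Rightarrow> 'a set"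
  where "minus_set u = {v. \<forall>t::real. t \<le> 0 \<longrightarrow> norm (u + t *\<^sub>R v) \<ge> norm u}"

end

theory Submission
  imports Defs
begin

text \<open>
  The nontrivial direction: for \<open>t > 0\<close>, compactness of the unit sphere gives a unit vector at which
  \<open>T + t A\<close> attains its norm, which is at least \<open>\<parallel>T\<parallel>\<close> by orthogonality. Hence the closed sets
  \<open>K t = {x. \<parallel>x\<parallel> = 1 \<and> \<parallel>T\<parallel> \<le> \<parallel>T x + t A x\<parallel>}\<close> are nonempty, and by convexity of the norm they
  increase with \<open>t\<close>. A point in all of them attains the norm of \<open>T\<close> (let \<open>t\<close> tend to \<open>0\<close>) and
  witnesses the plus condition; the minus condition is the plus condition for \<open>-A\<close>.
\<close>

text \<open>A convergent sequence is bounded, so its terms lie in a single one of these compact,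
  hence closed, pieces.\<close>

lemma closed_if_compact_cball_Int:
  fixes S :: "'a::real_normed_vector set"
  assumes "\<And>r. compact (cball 0 r \<inter> S)"
  shows "closed S"
proof (unfold closed_sequential_limits, intro allI impI, elim conjE)
  fix x l assume x: "\<forall>n. x n \<in> S" "x \<longlonglongrightarrow> l"
  then have "Bseq x"
    by (meson convergentI convergent_imp_Bseq)
  then obtain r where "\<And>n. norm (x n) \<le> r"
    by (auto simp: Bseq_def)
  then have "\<forall>n. x n \<in> cball 0 r \<inter> S"
    using x by auto
  then show "l \<in> S"
    using compact_imp_closed[OF assms[of r]] x(2)
    by (metis IntE closed_sequential_limits)
qed

text \<open>Heine-Borel for the span of a finite set, by induction on that set. All radii are
  treated at once: closedness of \<open>span B\<close> needs every radius, and the step for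
  \<open>b\<close> uses the larger radius \<open>R\<close>. Closedness keeps a new vector
  \<open>b\<close> at positive distance from \<open>span B\<close>, which confines both components
  of a bounded vector to compact sets.\<close>

lemma compact_cball_Int_span:
  fixes B :: "'a::real_normed_vector set"
  assumes "finite B"
  shows "compact (cball 0 r \<inter> span B)"
  using assms
proof (induction B arbitrary: r rule: finite_induct)
  case empty
  show ?case
    by (cases "0 \<in> cball (0::'a) r") (simp_all del: mem_cball)
next
  case (insert b B)
  have cl: "closed (span B)"
    by (rule closed_if_compact_cball_Int) (rule insert.IH)
  show ?case
  proof (cases "b \<in> span B")
    case True
    then show ?thesis
      using insert.IH by (simp add: span_redundant)
  next
    case False
    with cl obtain d where d: "d > 0" "ball b d \<subseteq> - span B"
      by (metis Compl_iff open_Compl open_contains_ball)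
    \<comment> \<open>The coefficient of \<open>b\<close> is bounded because \<open>b\<close> has distance at least \<open>d\<close> from \<open>span B\<close>.\<close>
    have coeff: "\<bar>k\<bar> * d \<le> norm x" if "x - k *\<^sub>R b \<in> span B" for x k
    proof (cases "k = 0")
      case False
      have "- (inverse k *\<^sub>R (x - k *\<^sub>R b)) \<in> span B"
        using that by (intro span_neg span_scale)
      then have "b - inverse k *\<^sub>R x \<in> span B"
        using False by (simp add: algebra_simps)
      then have "d \<le> dist b (b - inverse k *\<^sub>R x)"
        using d(2) by (force simp: not_less[symmetric])
      then show ?thesis
        using False by (simp add: dist_norm field_simps)
    qed auto
    \<comment> \<open>By \<open>coeff\<close>, a vector of norm at most \<open>r\<close> has
      \<open>b\<close>-coefficient at most \<open>r / d\<close> in absolute value, so the triangle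
      inequality bounds its remaining component by \<open>R\<close>.\<close>
    define R where "R = r + r / d * norm b"
    define C where "C = {- (r / d)..r / d} \<times> (cball 0 R \<inter> span B)"
    define f where "f = (\<lambda>(k, y). k *\<^sub>R b + y)"
    have "compact (f ` C)"
      unfolding C_def f_def
      by (intro compact_continuous_image compact_Times insert.IH compact_Icc)
        (auto simp: case_prod_unfold intro!: continuous_intros)
    moreover have "cball 0 r \<inter> span (insert b B) = cball 0 r \<inter> f ` C"
    proof (intro equalityI subsetI)
      fix x assume x: "x \<in> cball 0 r \<inter> span (insert b B)"
      then obtain k where k: "x - k *\<^sub>R b \<in> span B"
        by (auto simp: span_breakdown_eq)
      have kr: "\<bar>k\<bar> \<le> r / d"
        using coeff[OF k] x d(1) by (simp add: field_simps)
      have "norm (x - k *\<^sub>R b) \<le> norm x + \<bar>k\<bar> * norm b"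
        by (metis norm_scaleR norm_triangle_ineq4)
      also have "\<dots> \<le> R"
        unfolding R_def using x kr by (intro add_mono mult_right_mono) auto
      finally have "(k, x - k *\<^sub>R b) \<in> C"
        using k kr by (auto simp: C_def abs_le_iff)
      then have "f (k, x - k *\<^sub>R b) \<in> f ` C"
        by (rule imageI)
      then show "x \<in> cball 0 r \<inter> f ` C"
        using x by (simp add: f_def)
    next
      fix x assume "x \<in> cball 0 r \<inter> f ` C"
      then obtain k y where "x \<in> cball 0 r" "x = k *\<^sub>R b + y" "y \<in> span B"
        by (auto simp: f_def C_def)
      moreover from this have "x - k *\<^sub>R b \<in> span B"
        by simp
      ultimately show "x \<in> cball 0 r \<inter> span (insert b B)"
        using span_breakdown_eq[of x b B] by blast
    qed
    ultimately show ?thesis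
      by (simp add: closed_Int_compact)
  qed
qed

lemma compact_sphere_finite_span:
  fixes B :: "'a::real_normed_vector set"
  assumes "finite B" "span B = UNIV"
  shows "compact (sphere (0::'a) r)"
proof -
  have "closed {x::'a. norm x = r}"
    by (intro closed_Collect_eq continuous_intros)
  then have "compact ((cball 0 r \<inter> span B) \<inter> {x. norm x = r})"
    using compact_cball_Int_span[OF assms(1)] by (rule compact_Int_closed[rotated])
  also have "(cball 0 r \<inter> span B) \<inter> {x. norm x = r} = sphere 0 r"
    using assms(2) by auto
  finally show ?thesis .
qed

text \<open>By homogeneity, the maximum of \<open>norm (T x)\<close> over the unit sphere bounds
  \<open>T\<close> on all vectors.\<close>

lemma norm_blinfun_attained:
  fixes T :: "'a::real_normed_vector \<Rightarrow>\<^sub>L 'b::real_normed_vector"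
  assumes "compact (sphere (0::'a) 1)" "sphere (0::'a) 1 \<noteq> {}"
  obtains x where "norm x = 1" "norm (blinfun_apply T x) = norm T"
proof -
  have "continuous_on (sphere 0 1) (\<lambda>x. norm (blinfun_apply T x))"
    by (intro continuous_intros)
  then obtain x where x: "norm x = 1"
    and sup: "\<And>y. norm y = 1 \<Longrightarrow> norm (blinfun_apply T y) \<le> norm (blinfun_apply T x)"
    using continuous_attains_sup[OF assms] by force
  have "norm T \<le> norm (blinfun_apply T x)"
  proof (rule norm_blinfun_bound)
    fix y
    show "norm (blinfun_apply T y) \<le> norm (blinfun_apply T x) * norm y"
    proof (cases "y = 0")
      case False
      then have "norm (blinfun_apply T (y /\<^sub>R norm y)) \<le> norm (blinfun_apply T x)"
        by (intro sup) simp
      then show ?thesis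
        using False by (simp add: blinfun.scaleR_right field_simps)
    qed simp
  qed simp
  moreover have "norm (blinfun_apply T x) \<le> norm T"
    using norm_blinfun[of T x] x by simp
  ultimately show thesis
    using that x by force
qed

text \<open>The point \<open>u + s v\<close> is a convex combination of \<open>u\<close> and
  \<open>u + t v\<close>. If its norm is at least \<open>N\<close> while that of \<open>u\<close> is
  at most \<open>N\<close>, the other endpoint must reach \<open>N\<close>.\<close>

lemma norm_add_scaleR_ge_mono:
  fixes u v :: "'a::real_normed_vector"
  assumes "norm u \<le> N" "N \<le> norm (u + s *\<^sub>R v)" "0 < s" "s \<le> t"
  shows "N \<le> norm (u + t *\<^sub>R v)"
proof -
  have "t * N \<le> norm (t *\<^sub>R (u + s *\<^sub>R v))"
    using assms by (simp add: mult_left_mono)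
  also have "t *\<^sub>R (u + s *\<^sub>R v) = s *\<^sub>R (u + t *\<^sub>R v) + (t - s) *\<^sub>R u"
    by (simp add: algebra_simps)
  also have "norm \<dots> \<le> s * norm (u + t *\<^sub>R v) + (t - s) * norm u"
    using assms by (intro order_trans[OF norm_triangle_ineq]) simp
  also have "\<dots> \<le> s * norm (u + t *\<^sub>R v) + (t - s) * N"
    using assms by (intro add_left_mono mult_left_mono) auto
  finally have "s * N \<le> s * norm (u + t *\<^sub>R v)"
    by (simp add: algebra_simps)
  then show ?thesis
    using assms by simp
qed

lemma bj_orth_imp_plus_set:
  fixes T A :: "'a::real_normed_vector \<Rightarrow>\<^sub>L 'b::real_normed_vector"
  assumes compact: "compact (sphere (0::'a) 1)" and nonempty: "sphere (0::'a) 1 \<noteq> {}"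
    and orth: "T \<bottom>\<^sub>B A"
  shows "\<exists>x\<in>norm_attainment_set T. blinfun_apply A x \<in> plus_set (blinfun_apply T x)"
proof -
  \<comment> \<open>The constraint \<open>norm x = 1\<close> is left out here: the finite
    intersection property is applied to the compact sphere and sets \<open>K t\<close> closed in the
    whole space.\<close>
  define K where
    "K = (\<lambda>t. {x. norm T \<le> norm (blinfun_apply T x + t *\<^sub>R blinfun_apply A x)})"
  have K_nonempty: "sphere 0 1 \<inter> K t \<noteq> {}" for t
  proof -
    obtain x where x: "norm x = 1" "norm (blinfun_apply (T + t *\<^sub>R A) x) = norm (T + t *\<^sub>R A)"
      using norm_blinfun_attained[OF compact nonempty] .
    have "norm T \<le> norm (T + t *\<^sub>R A)"
      using orth by (simp add: bj_orth_def)
    with x have "x \<in> sphere 0 1 \<inter> K t"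
      by (simp add: K_def blinfun.bilinear_simps)
    then show ?thesis by blast
  qed
  have T_le: "norm (blinfun_apply T x) \<le> norm T" if "norm x = 1" for x
    using norm_blinfun[of T x] that by simp
  have K_mono: "sphere 0 1 \<inter> K s \<subseteq> K t" if "0 < s" "s \<le> t" for s t
    using norm_add_scaleR_ge_mono that T_le by (fastforce simp: K_def)
  have "sphere 0 1 \<inter> (\<Inter>t\<in>{0<..}. K t) \<noteq> {}"
  proof (rule compact_imp_fip_image[OF compact])
    show "closed (K t)" for t
      unfolding K_def by (intro closed_Collect_le continuous_intros)
  next
    fix I :: "real set" assume I: "finite I" "I \<subseteq> {0<..}"
    \<comment> \<open>Inserting 1 keeps the minimum defined and positive when \<open>I\<close> is
      empty.\<close>
    define s where "s = Min (insert 1 I)"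
    have "0 < s" "\<forall>t\<in>I. s \<le> t"
      using I by (auto simp: s_def)
    then have "sphere 0 1 \<inter> K s \<subseteq> sphere 0 1 \<inter> (\<Inter>t\<in>I. K t)"
      using K_mono by blast
    then show "sphere 0 1 \<inter> (\<Inter>t\<in>I. K t) \<noteq> {}"
      using K_nonempty by blast
  qed
  then obtain x where x: "norm x = 1"
    and ge: "\<And>t. t > 0 \<Longrightarrow> norm T \<le> norm (blinfun_apply T x + t *\<^sub>R blinfun_apply A x)"
    unfolding K_def by force
  have "((\<lambda>t. norm (blinfun_apply T x + t *\<^sub>R blinfun_apply A x)) \<longlongrightarrow>
      norm (blinfun_apply T x + 0 *\<^sub>R blinfun_apply A x)) (at_right 0)"
    by (intro tendsto_intros)
  then have "norm T \<le> norm (blinfun_apply T x)"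
    using ge by (intro tendsto_lowerbound[where F = "at_right (0::real)"])
      (auto simp: eventually_at_right_less eventually_at_filter)
  then have eq: "norm (blinfun_apply T x) = norm T"
    using T_le[OF x] by simp
  have "norm T \<le> norm (blinfun_apply T x + t *\<^sub>R blinfun_apply A x)" if "t \<ge> 0" for t
    using that ge[of t] eq by (cases "t = 0") auto
  then show ?thesis
    using x eq by (auto simp: norm_attainment_set_def plus_set_def)
qed

lemma bj_orth_minus_right: "u \<bottom>\<^sub>B v \<Longrightarrow> u \<bottom>\<^sub>B - v"
  unfolding bj_orth_def by (metis scaleR_minus_left scaleR_minus_right)

lemma uminus_in_plus_set_iff: "- v \<in> plus_set u \<longleftrightarrow> v \<in> minus_set u"
proof -
  have "(\<forall>t\<ge>0. norm u \<le> norm (u + t *\<^sub>R - v)) \<longleftrightarrow> (\<forall>t\<le>0. norm u \<le> norm (u + t *\<^sub>R v))"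
    by (metis neg_0_le_iff_le neg_le_0_iff_le scaleR_minus_left scaleR_minus_right add.inverse_inverse)
  then show ?thesis
    by (simp add: plus_set_def minus_set_def)
qed

text \<open>For the converse direction: evaluating at a unit vector where \<open>T\<close> attains
  its norm transfers the pointwise inequality, for one \<open>t\<close>, to operator norms.\<close>

lemma norm_le_norm_add_scaleR_blinfun:
  assumes "x \<in> norm_attainment_set T"
    and "norm (blinfun_apply T x) \<le> norm (blinfun_apply T x + t *\<^sub>R blinfun_apply A x)"
  shows "norm T \<le> norm (T + t *\<^sub>R A)"
proof -
  have "norm T \<le> norm (blinfun_apply (T + t *\<^sub>R A) x)"
    using assms by (simp add: norm_attainment_set_def blinfun.bilinear_simps)
  also have "\<dots> \<le> norm (T + t *\<^sub>R A)"
    using norm_blinfun[of "T + t *\<^sub>R A" x] assms(1) by (simp add: norm_attainment_set_def)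
  finally show ?thesis .
qed

theorem corollary3p4p1:
  fixes T A :: "'a::banach \<Rightarrow>\<^sub>L 'b::banach"
  assumes "\<exists>B::'a set. finite B \<and> span B = UNIV"
    and "dim (UNIV :: 'a set) > 1"
  shows "T \<bottom>\<^sub>B A \<longleftrightarrow>
    (\<exists>x\<in>norm_attainment_set T. \<exists>y\<in>norm_attainment_set T.
       blinfun_apply A x \<in> plus_set (blinfun_apply T x) \<and>
       blinfun_apply A y \<in> minus_set (blinfun_apply T y))"
proof
  assume orth: "T \<bottom>\<^sub>B A"
  have compact: "compact (sphere (0::'a) 1)"
    using assms(1) compact_sphere_finite_span by blast
  \<comment> \<open>The set {0} is the span of the empty set; comparing dimensions then yields a
    nonzero vector to normalise.\<close>
  have "dim {0::'a} = 0"
    using dim_span[of "{} :: 'a set"] dim_eq_card_independent[OF independent_empty, where ?'a = 'a]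
    by simp
  then have "(UNIV :: 'a set) \<noteq> {0}"
    using assms(2) by (metis not_less_zero)
  then obtain z :: 'a where "z \<noteq> 0"
    by blast
  then have "z /\<^sub>R norm z \<in> sphere 0 1"
    by simp
  then have nonempty: "sphere (0::'a) 1 \<noteq> {}"
    by blast
  show "\<exists>x\<in>norm_attainment_set T. \<exists>y\<in>norm_attainment_set T.
       blinfun_apply A x \<in> plus_set (blinfun_apply T x) \<and>
       blinfun_apply A y \<in> minus_set (blinfun_apply T y)"
    using bj_orth_imp_plus_set[OF compact nonempty orth]
      bj_orth_imp_plus_set[OF compact nonempty bj_orth_minus_right[OF orth]]
    by (auto simp: blinfun.minus_left uminus_in_plus_set_iff)
next
  assume "\<exists>x\<in>norm_attainment_set T. \<exists>y\<in>norm_attainment_set T.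
       blinfun_apply A x \<in> plus_set (blinfun_apply T x) \<and>
       blinfun_apply A y \<in> minus_set (blinfun_apply T y)"
  then obtain x y where xy: "x \<in> norm_attainment_set T" "y \<in> norm_attainment_set T"
    "blinfun_apply A x \<in> plus_set (blinfun_apply T x)"
    "blinfun_apply A y \<in> minus_set (blinfun_apply T y)"
    by blast
  \<comment> \<open>The witness \<open>x\<close> serves nonnegative \<open>t\<close>, and
    \<open>y\<close> serves negative \<open>t\<close>.\<close>
  have "norm T \<le> norm (T + t *\<^sub>R A)" for t
  proof (cases "t \<ge> 0")
    case True
    then show ?thesis
      using xy by (auto simp: plus_set_def intro: norm_le_norm_add_scaleR_blinfun)
  next
    case False
    then show ?thesis
      using xy by (auto simp: minus_set_def intro: norm_le_norm_add_scaleR_blinfun)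
  qed
  then show "T \<bottom>\<^sub>B A"
    by (simp add: bj_orth_def)
qed

end
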